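(* Let $k=\mathbb{Q}[y,y^{-1}]$ and let $H_n(X)$ denote the Yang-Baxter homology of $X=(V,R)$, as defined in the context. Then $$H_2(X)\cong k^2\oplus k/(y^2-1)\oplus k/(y^4-1)$$ as $k$-modules.
   Context: $V$ is the free $k$-module with basis $e_1,e_2$; tensor products are over $k$, and $\mathbb{1}^m$ is the identity of $V^{\otimes m}$ ($V^{\otimes0}=k$). The map $R:V\otimes V\to V\otimes V$ is the $k$-linear map with $R(e_1\otimes e_1)=e_1\otimes e_1$, $R(e_1\otimes e_2)=(1-y^2)e_1\otimes e_2+y^2e_2\otimes e_1$, $R(e_2\otimes e_1)=e_1\otimes e_2$, $R(e_2\otimes e_2)=e_2\otimes e_2$. Let $\mu:V\to k$ be the $k$-linear map with $\mu(e_1)=\mu(e_2)=1$. For $1\le i\le n$ define $d^\ell_{i,n},d^r_{i,n}:V^{\otimes n}\to V^{\otimes(n-1)}$ by $$d^\ell_{i,n}=(\mu\otimes\mathbb{1}^{n-1})\circ(R\otimes\mathbb{1}^{n-2})\circ(\mathbb{1}\otimes R\otimes\mathbb{1}^{n-3})\circ\cdots\circ(\mathbb{1}^{i-2}\otimes R\otimes\mathbb{1}^{n-i}),$$ $$d^r_{i,n}=(\mathbb{1}^{n-1}\otimes\mu)\circ(\mathbb{1}^{n-2}\otimes R)\circ(\mathbb{1}^{n-3}\otimes R\otimes\mathbb{1})\circ\cdots\circ(\mathbb{1}^{i-1}\otimes R\otimes\mathbb{1}^{n-i-1}),$$ (so $d^\ell_{1,n}=\mu\otimes\mathbb{1}^{n-1}$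 and $d^r_{n,n}=\mathbb{1}^{n-1}\otimes\mu$). Set $C_n(X)=V^{\otimes n}$ and $d_n=\sum_{i=1}^n(-1)^i[\,d^\ell_{i,n}-d^r_{i,n}\,]:C_n(X)\to C_{n-1}(X)$. These form a chain complex, and $H_n(X)=\ker d_n/\operatorname{im}d_{n+1}$. *)

theory Defs
  imports
    "HOL-Library.Poly_Mapping"
    "HOL-Algebra.AbelCoset"
    "HOL-Algebra.Ideal"
    "Jordan_Normal_Form.VS_Connect"
begin

section \<open>The ground ring\<close>

text \<open>
  Finitely supported functions from the integers to the rationals, multiplied by convolution:
  the group algebra of the infinite cyclic group, i.e. the Laurent polynomials
  $\mathbb{Q}[y, y^{-1}]$.
\<close>

type_synonym laurent = "int \<Rightarrow>\<^sub>0 rat"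

definition Y :: laurent where
  "Y = Poly_Mapping.single 1 1"


section \<open>Tensor powers of the free module of rank two\<close>

datatype ix = I1 | I2

text \<open>
  $V^{\otimes n}$ is the free module on the basis $e_{i_1} \otimes \dots \otimes e_{i_n}$. This basis
  is indexed by the words $i_1 \dots i_n$ of length $n$, and an element is given by its coordinates,
  a function on words that vanishes on all words of other lengths. In particular
  $V^{\otimes 0}$ is the ground ring (supported on the empty word).
\<close>

type_synonym 'k tensor = "ix list \<Rightarrow> 'k"

definition words :: "nat \<Rightarrow> ix list set" where
  "words n = {w. length w = n}"

text \<open>The multiplicative fields of the record play no role for a module.\<close>

definition tensor_power :: "nat \<Rightarrow> ('k::comm_ring_1, 'k tensor) module" where
  "tensor_power n =
    \<lparr>carrier = {x. \<forall>w. w \<notin> words n \<longrightarrow> x w = 0},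
     mult = (\<lambda>_ _ _. 0), one = (\<lambda>_. 0),
     zero = (\<lambda>_. 0), add = (\<lambda>x z w. x w + z w),
     smult = (\<lambda>a x w. a * x w)\<rparr>"

definition basis_tensor :: "ix list \<Rightarrow> 'k::comm_ring_1 tensor" where
  "basis_tensor u = (\<lambda>w. if w = u then 1 else 0)"

abbreviation ebas :: "ix \<Rightarrow> 'k::comm_ring_1 tensor" where
  "ebas i \<equiv> basis_tensor [i]"

text \<open>
  The product of the tensor algebra. If \<open>x\<close> has degree \<open>m\<close> and \<open>z\<close> has degree \<open>n\<close>,
  only the summand \<open>i = m\<close> can be nonzero, and only if the length of \<open>w\<close> is \<open>m + n\<close>.
\<close>

definition tens :: "'k::comm_ring_1 tensor \<Rightarrow> 'k tensor \<Rightarrow> 'k tensor" (infixr \<open>\<otimes>\<^sub>t\<close> 72) where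
  "x \<otimes>\<^sub>t z = (\<lambda>w. \<Sum>i\<le>length w. x (take i w) * z (drop i w))"

text \<open>The linear map on $V^{\otimes n}$ with prescribed values on the basis.\<close>

definition lin_ext :: "nat \<Rightarrow> (ix list \<Rightarrow> 'k tensor) \<Rightarrow> 'k::comm_ring_1 tensor \<Rightarrow> 'k tensor" where
  "lin_ext n f x = (\<lambda>w. \<Sum>u\<in>words n. x u * f u w)"

text \<open>
  The map $f \otimes g$ for linear maps $f$, $g$ with sources $V^{\otimes m}$ and $V^{\otimes n}$.
\<close>

definition tens_map ::
  "nat \<Rightarrow> nat \<Rightarrow> ('k::comm_ring_1 tensor \<Rightarrow> 'k tensor) \<Rightarrow> ('k tensor \<Rightarrow> 'k tensor) \<Rightarrow>
    'k tensor \<Rightarrow> 'k tensor" where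
  "tens_map m n f g =
    lin_ext (m + n) (\<lambda>w. f (basis_tensor (take m w)) \<otimes>\<^sub>t g (basis_tensor (drop m w)))"


section \<open>The Yang-Baxter operator and its chain complex\<close>

fun R_basis :: "ix \<Rightarrow> ix \<Rightarrow> laurent tensor" where
  "R_basis I1 I1 = ebas I1 \<otimes>\<^sub>t ebas I1"
| "R_basis I1 I2 = (\<lambda>w. (1 - Y\<^sup>2) * (ebas I1 \<otimes>\<^sub>t ebas I2) w + Y\<^sup>2 * (ebas I2 \<otimes>\<^sub>t ebas I1) w)"
| "R_basis I2 I1 = ebas I1 \<otimes>\<^sub>t ebas I2"
| "R_basis I2 I2 = ebas I2 \<otimes>\<^sub>t ebas I2"

definition R_op :: "laurent tensor \<Rightarrow> laurent tensor" where
  "R_op = lin_ext 2 (\<lambda>w. R_basis (w ! 0) (w ! 1))"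

definition mu_op :: "laurent tensor \<Rightarrow> laurent tensor" where
  "mu_op = lin_ext 1 (\<lambda>_. basis_tensor [])"

text \<open>$\mathbb{1}^a \otimes R \otimes \mathbb{1}^b$\<close>

definition R_at :: "nat \<Rightarrow> nat \<Rightarrow> laurent tensor \<Rightarrow> laurent tensor" where
  "R_at a b = tens_map a (2 + b) id (tens_map 2 b R_op id)"

definition compose_list :: "('a \<Rightarrow> 'a) list \<Rightarrow> 'a \<Rightarrow> 'a" where
  "compose_list fs = foldr (\<circ>) fs id"

text \<open>
  \<open>compose_list\<close> applies its last map first. In \<open>R_at j (n - 2 - j)\<close> the parameter \<open>j\<close> counts the
  identity factors to the left of $R$; it runs through $0, \dots, i-2$ in $d^\ell_{i,n}$ and through
  $n-2, \dots, i-1$ in $d^r_{i,n}$ (from the outermost factor to the innermost).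
\<close>

definition d_left :: "nat \<Rightarrow> nat \<Rightarrow> laurent tensor \<Rightarrow> laurent tensor" where
  "d_left i n =
    tens_map 1 (n - 1) mu_op id \<circ> compose_list (map (\<lambda>j. R_at j (n - 2 - j)) [0..<i - 1])"

definition d_right :: "nat \<Rightarrow> nat \<Rightarrow> laurent tensor \<Rightarrow> laurent tensor" where
  "d_right i n =
    tens_map (n - 1) 1 id mu_op \<circ> compose_list (map (\<lambda>j. R_at j (n - 2 - j)) (rev [i - 1..<n - 1]))"

abbreviation chain_module :: "nat \<Rightarrow> (laurent, laurent tensor) module" where
  "chain_module n \<equiv> tensor_power n"

definition d_map :: "nat \<Rightarrow> laurent tensor \<Rightarrow> laurent tensor" where
  "d_map n x = (\<lambda>w. \<Sum>i=1..n. (-1) ^ i * (d_left i n x w - d_right i n x w))"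


section \<open>Quotient modules, homology and isomorphism\<close>

text \<open>
  The coset \<open>a \<odot> X\<close> has to be saturated with \<open>N\<close>: for \<open>X = N + x\<close> the set of all \<open>a \<odot> z\<close>,
  \<open>z \<in> X\<close>, is in general smaller than the coset of \<open>a \<odot> x\<close>.
\<close>

definition quotient_module :: "('a, 'b, 'c) module_scheme \<Rightarrow> 'b set \<Rightarrow> ('a, 'b set) module" where
  "quotient_module M N =
    \<lparr>carrier = a_rcosets\<^bsub>M\<^esub> N,
     mult = (\<lambda>_ _. N), one = N,
     zero = N, add = (<+>\<^bsub>M\<^esub>),
     smult = (\<lambda>a X. N <+>\<^bsub>M\<^esub> ((\<lambda>x. a \<odot>\<^bsub>M\<^esub> x) ` X))\<rparr>"

definition homology :: "nat \<Rightarrow> (laurent, laurent tensor set) module" where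
  "homology n =
    quotient_module
      ((chain_module n)\<lparr>carrier := a_kernel (chain_module n) (chain_module (n - 1)) (d_map n)\<rparr>)
      (d_map (n + 1) ` carrier (chain_module (n + 1)))"

definition regular_module :: "('a, 'b) ring_scheme \<Rightarrow> ('a, 'a) module" where
  "regular_module S =
    \<lparr>carrier = carrier S, mult = mult S, one = one S, zero = zero S, add = add S,
     smult = mult S\<rparr>"

definition module_iso ::
  "('a, 'm) ring_scheme \<Rightarrow> ('a, 'b, 'n) module_scheme \<Rightarrow> ('a, 'c, 'p) module_scheme \<Rightarrow> bool" where
  "module_iso S M N \<longleftrightarrow> (\<exists>f \<in> LinearCombinations.module_hom S M N. bij_betw f (carrier M) (carrier N))"

abbreviation k_ring :: "laurent ring" where
  "k_ring \<equiv> class_ring"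

abbreviation k_module :: "(laurent, laurent) module" where
  "k_module \<equiv> regular_module k_ring"

abbreviation k_mod :: "laurent \<Rightarrow> (laurent, laurent set) module" where
  "k_mod a \<equiv> quotient_module k_module (PIdl\<^bsub>k_ring\<^esub> a)"

end

theory Submission
  imports Defs
begin

text \<open>
  The differential $d_2$ vanishes, and $d_3$ kills all basis tensors except $e_1 \otimes e_1 \otimes e_2$
  and $e_1 \otimes e_2 \otimes e_2$. With $q = y^2$, $v = e_{12} + q e_{21} - (1 + q) e_{22}$ and
  $w = e_{11} - e_{22}$, their images are $(q - 1) v - (q^2 - 1) w$ and $-(q - 1) v$, so the boundaries
  are spanned by $(q - 1) v$ and $(q^2 - 1) w$. As $v, w, e_{21}, e_{22}$ is a basis of
  $V \otimes V$, the cokernel is as claimed; the isomorphism reads off the coordinates with respect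
  to this basis.
\<close>


section \<open>Quotients of modules\<close>

text \<open>Negation is scalar multiplication by minus one, so closure under scalars gives closure
  under inverses. This makes the coset theory of abelian groups available for submodules.\<close>

lemma submodule_imp_abelian_subgroup:
  assumes "LinearCombinations.submodule R N M"
  shows "abelian_subgroup N M"
proof -
  interpret N: LinearCombinations.submodule R N M by fact
  interpret Module.module R M by (rule N.module)
  have "\<ominus>\<^bsub>M\<^esub> x \<in> N" if "x \<in> N" for x
  proof -
    have "\<ominus>\<^bsub>M\<^esub> x = (\<ominus>\<^bsub>R\<^esub> \<one>\<^bsub>R\<^esub>) \<odot>\<^bsub>M\<^esub> x"
      using that N.subset smult_minus_1 by auto
    then show ?thesis
      using that N.smult_closed by simp
  qed
  moreover have "N \<noteq> {}"
    using N.zero_closed by blast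
  ultimately have "subgroup N (add_monoid M)"
    using N.subset by (intro M.add.subgroupI) auto
  then show ?thesis
    by (intro abelian_subgroupI3 additive_subgroup.intro abelian_group_axioms)
qed

lemma a_r_coset_eq_iff:
  assumes "abelian_subgroup N M" and "x \<in> carrier M" and "y \<in> carrier M"
  shows "N +>\<^bsub>M\<^esub> x = N +>\<^bsub>M\<^esub> y \<longleftrightarrow> x \<ominus>\<^bsub>M\<^esub> y \<in> N"
proof -
  interpret abelian_subgroup N M by fact
  show ?thesis
    using assms(2,3) a_repr_independence' a_repr_independenceD a_rcos_module [OF assms(3,2)]
    by (metis minus_eq)
qed

lemma coset_map_module_hom:
  assumes N: "LinearCombinations.submodule R N M"
  shows "(\<lambda>x. N +>\<^bsub>M\<^esub> x) \<in> LinearCombinations.module_hom R M (quotient_module M N)"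
proof -
  interpret Module.module R M
    using N by (rule LinearCombinations.submodule.module)
  interpret N: abelian_subgroup N M
    using N by (rule submodule_imp_abelian_subgroup)
  \<comment> \<open>For one inclusion, \<open>x\<close> lies in its own coset; for the other,
    \<open>N\<close> absorbs the term \<open>a \<odot> h\<close> because it is closed under
    scalars.\<close>
  have smult: "N +>\<^bsub>M\<^esub> (a \<odot>\<^bsub>M\<^esub> x) = N <+>\<^bsub>M\<^esub> (\<lambda>z. a \<odot>\<^bsub>M\<^esub> z) ` (N +>\<^bsub>M\<^esub> x)"
    if a: "a \<in> carrier R" and x: "x \<in> carrier M" for a x
  proof (intro equalityI subsetI)
    fix z assume "z \<in> N +>\<^bsub>M\<^esub> (a \<odot>\<^bsub>M\<^esub> x)"
    then obtain n where "n \<in> N" "z = n \<oplus>\<^bsub>M\<^esub> a \<odot>\<^bsub>M\<^esub> x"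
      by (auto simp: a_r_coset_def')
    moreover have "x \<in> N +>\<^bsub>M\<^esub> x"
      using x by (rule N.a_rcos_self)
    ultimately show "z \<in> N <+>\<^bsub>M\<^esub> (\<lambda>z. a \<odot>\<^bsub>M\<^esub> z) ` (N +>\<^bsub>M\<^esub> x)"
      by (auto simp: set_add_def')
  next
    fix z assume "z \<in> N <+>\<^bsub>M\<^esub> (\<lambda>z. a \<odot>\<^bsub>M\<^esub> z) ` (N +>\<^bsub>M\<^esub> x)"
    then obtain n h where nh: "n \<in> N" "h \<in> N" and z: "z = n \<oplus>\<^bsub>M\<^esub> a \<odot>\<^bsub>M\<^esub> (h \<oplus>\<^bsub>M\<^esub> x)"
      by (auto simp: set_add_def' a_r_coset_def')
    have "z = (n \<oplus>\<^bsub>M\<^esub> a \<odot>\<^bsub>M\<^esub> h) \<oplus>\<^bsub>M\<^esub> a \<odot>\<^bsub>M\<^esub> x"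
      using nh a x by (simp add: z smult_r_distr M.a_assoc)
    moreover have "n \<oplus>\<^bsub>M\<^esub> a \<odot>\<^bsub>M\<^esub> h \<in> N"
      using nh LinearCombinations.submodule.smult_closed [OF N a] by blast
    ultimately show "z \<in> N +>\<^bsub>M\<^esub> (a \<odot>\<^bsub>M\<^esub> x)"
      by (auto simp: a_r_coset_def')
  qed
  show ?thesis
    using smult N.a_rcos_sum
    by (auto simp: LinearCombinations.module_hom_def quotient_module_def A_RCOSETS_def' Pi_iff)
qed

text \<open>First isomorphism theorem. The kernel is described by comparing fibres of
  \<open>f\<close>, so \<open>P\<close> enters only as a record of operations, and a direct sum of
  quotients can serve as \<open>P\<close> directly.\<close>

lemma module_iso_quotient_module:
  assumes N: "LinearCombinations.submodule R N M"
    and f: "f \<in> LinearCombinations.module_hom R M P"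
    and surj: "f ` carrier M = carrier P"
    and ker: "\<And>x y. x \<in> carrier M \<Longrightarrow> y \<in> carrier M \<Longrightarrow> f x = f y \<longleftrightarrow> x \<ominus>\<^bsub>M\<^esub> y \<in> N"
  shows "module_iso R (quotient_module M N) P"
proof -
  interpret Module.module R M
    using N by (rule LinearCombinations.submodule.module)
  interpret N: abelian_subgroup N M
    using N by (rule submodule_imp_abelian_subgroup)
  \<comment> \<open>A coset is sent to the value of \<open>f\<close> at a chosen representative; by
    \<open>ker\<close> the choice does not affect the value.\<close>
  define F where "F X = f (SOME x. x \<in> carrier M \<and> X = N +>\<^bsub>M\<^esub> x)" for X
  have F: "F (N +>\<^bsub>M\<^esub> x) = f x" if x: "x \<in> carrier M" for x
  proof -
    let ?P = "\<lambda>z. z \<in> carrier M \<and> N +>\<^bsub>M\<^esub> x = N +>\<^bsub>M\<^esub> z"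
    have "?P (SOME z. ?P z)"
      using x by (intro someI [of ?P x]) simp
    then have "f x = f (SOME z. ?P z)"
      using x ker a_r_coset_eq_iff [OF N.abelian_subgroup_axioms] by blast
    then show ?thesis
      by (simp add: F_def)
  qed
  note hom = coset_map_module_hom [OF N, unfolded LinearCombinations.module_hom_def]
  have carrier: "carrier (quotient_module M N) = (\<lambda>x. N +>\<^bsub>M\<^esub> x) ` carrier M"
    by (auto simp: quotient_module_def A_RCOSETS_def')
  have "F \<in> LinearCombinations.module_hom R (quotient_module M N) P"
    using hom f
    by (auto simp: LinearCombinations.module_hom_def carrier F Pi_iff)
      (metis F M.a_closed smult_closed)+
  moreover have "bij_betw F (carrier (quotient_module M N)) (carrier P)"
    using surj ker a_r_coset_eq_iff [OF N.abelian_subgroup_axioms]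
    by (auto simp: bij_betw_def inj_on_def carrier F image_image)
  ultimately show ?thesis
    by (auto simp: module_iso_def)
qed

section \<open>Tensor powers and the ground ring as modules; principal ideals\<close>

lemma module_tensor_power: "module class_ring (tensor_power n)"
proof -
  have "\<exists>y. (\<forall>w. w \<notin> words n \<longrightarrow> y w = 0) \<and> (\<forall>w. y w + x w = 0)"
    if "\<forall>w. w \<notin> words n \<longrightarrow> x w = 0" for x :: "'a tensor"
    using that by (intro exI [of _ "\<lambda>w. - x w"]) simp
  then show ?thesis
    by (intro Module.moduleI class_cring.cring_axioms abelian_groupI)
      (auto simp: tensor_power_def fun_eq_iff algebra_simps)
qed

lemma module_regular_module:
  assumes "cring S"
  shows "module S (regular_module S)"
proof -
  interpret cring S by fact
  show ?thesis
    by (intro Module.moduleI abelian_groupI cring_axioms)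
      (auto simp: regular_module_def m_assoc a_ac l_distr r_distr intro: l_neg)
qed

lemma submodule_cgenideal:
  assumes "cring S" and "a \<in> carrier S"
  shows "LinearCombinations.submodule S (PIdl\<^bsub>S\<^esub> a) (regular_module S)"
proof -
  interpret cring S by fact
  interpret I: ideal "PIdl\<^bsub>S\<^esub> a" S
    using assms(2) by (rule cgenideal_ideal)
  show ?thesis
    using module_regular_module [OF assms(1)] I.I_l_closed I.a_subset I.zero_closed I.a_closed
    by (auto simp: LinearCombinations.submodule_def regular_module_def)
qed

text \<open>Subtraction is built from the additive fields alone, and these are copied from the
  ring.\<close>

lemma a_minus_regular_module: "a_minus (regular_module S) = a_minus S"
  by (simp add: a_minus_def a_inv_def m_inv_def regular_module_def fun_eq_iff)

lemma mem_cgenideal_class_ring_iff: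
  "x \<in> PIdl\<^bsub>class_ring\<^esub> a \<longleftrightarrow> a dvd x" for a x :: "'a::comm_ring_1"
  by (auto simp: cgenideal_def dvd_def mult.commute)

lemma a_minus_tensor_power:
  assumes "x \<in> carrier (tensor_power n)" and "y \<in> carrier (tensor_power n)"
  shows "x \<ominus>\<^bsub>tensor_power n\<^esub> y = (\<lambda>w. x w - y w)"
proof -
  interpret Module.module class_ring "tensor_power n"
    by (rule module_tensor_power)
  have "\<ominus>\<^bsub>tensor_power n\<^esub> y = (\<lambda>w. - y w)"
    using assms(2) by (intro M.minus_equality) (auto simp: tensor_power_def)
  then show ?thesis
    by (simp add: a_minus_def) (simp add: tensor_power_def)
qed


section \<open>Linear maps on tensor powers\<close>

lemma words_0: "words 0 = {[]}"
  by (simp add: words_def)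

lemma words_Suc: "words (Suc n) = (#) I1 ` words n \<union> (#) I2 ` words n"
  by (auto simp: words_def length_Suc_conv image_iff) (metis ix.exhaust)

lemma finite_words [simp]: "finite (words n)"
  by (induction n) (simp_all add: words_0 words_Suc)

lemma sum_words_Suc:
  "(\<Sum>u\<in>words (Suc n). f u) = (\<Sum>u\<in>words n. f (I1 # u)) + (\<Sum>u\<in>words n. f (I2 # u))"
proof -
  have "(\<Sum>u\<in>words (Suc n). f u) = (\<Sum>u\<in>(#) I1 ` words n. f u) + (\<Sum>u\<in>(#) I2 ` words n. f u)"
    unfolding words_Suc by (rule sum.union_disjoint) auto
  then show ?thesis
    by (simp add: sum.reindex)
qed

lemma lin_ext_basis_tensor:
  "u \<in> words n \<Longrightarrow> lin_ext n f (basis_tensor u) = f u"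
  by (simp add: lin_ext_def basis_tensor_def fun_eq_iff if_distrib [of "\<lambda>c. c * _"]
      cong: if_cong)

text \<open>The two-term shape is that of \<open>R_basis I1 I2\<close>, the one value of
  \<open>R\<close> that is not a single basis tensor. The other linearity rules share it, so
  rewriting can carry this sum through tensor products and compositions.\<close>

lemma lin_ext_linear:
  "lin_ext n f (\<lambda>w. a * x w + b * z w) = (\<lambda>w. a * lin_ext n f x w + b * lin_ext n f z w)"
  by (simp add: lin_ext_def fun_eq_iff sum_distrib_left sum.distrib algebra_simps)

lemma tens_linear_left:
  "(\<lambda>w. a * x w + b * x' w) \<otimes>\<^sub>t z = (\<lambda>w. a * (x \<otimes>\<^sub>t z) w + b * (x' \<otimes>\<^sub>t z) w)"
  by (simp add: tens_def fun_eq_iff sum_distrib_left sum.distrib algebra_simps)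

lemma tens_linear_right:
  "z \<otimes>\<^sub>t (\<lambda>w. a * x w + b * x' w) = (\<lambda>w. a * (z \<otimes>\<^sub>t x) w + b * (z \<otimes>\<^sub>t x') w)"
  by (simp add: tens_def fun_eq_iff sum_distrib_left sum.distrib algebra_simps)

lemma tens_basis_tensor [simp]:
  "basis_tensor u \<otimes>\<^sub>t basis_tensor v = basis_tensor (u @ v)"
proof
  fix w
  \<comment> \<open>Among all cuts of \<open>w\<close>, only the one at \<open>length u\<close> can
    match both factors.\<close>
  have "basis_tensor u (take i w) * basis_tensor v (drop i w) =
      (if i = length u then (if w = u @ v then 1 else 0) else 0 :: 'a)" if "i \<le> length w" for i
  proof -
    have "take i w = u \<and> drop i w = v \<longleftrightarrow> i = length u \<and> w = u @ v"
      using that append_take_drop_id [of i w] by fastforce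
    moreover have "basis_tensor u (take i w) * basis_tensor v (drop i w) =
        (if take i w = u \<and> drop i w = v then 1 else 0 :: 'a)"
      by (simp add: basis_tensor_def)
    ultimately show ?thesis
      by simp
  qed
  then have "(basis_tensor u \<otimes>\<^sub>t basis_tensor v) w =
      (\<Sum>i\<le>length w. if i = length u then (if w = u @ v then 1 else 0) else 0 :: 'a)"
    unfolding tens_def by (intro sum.cong) simp_all
  also have "\<dots> = basis_tensor (u @ v) w"
    by (auto simp: basis_tensor_def)
  finally show "(basis_tensor u \<otimes>\<^sub>t basis_tensor v) w = (basis_tensor (u @ v) w :: 'a)" .
qed

lemma tens_map_basis_tensor:
  assumes "length u = m" and "length v = n"
  shows "tens_map m n f g (basis_tensor (u @ v)) = f (basis_tensor u) \<otimes>\<^sub>t g (basis_tensor v)"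
  using assms by (simp add: tens_map_def lin_ext_basis_tensor words_def)

text \<open>Linearity as expansion over the basis words of the source, for every function
  \<open>x\<close>; it thus includes that coordinates outside \<open>words n\<close> are ignored.
  The degree of the values is left open.\<close>

definition tensor_linear :: "nat \<Rightarrow> ('k::comm_ring_1 tensor \<Rightarrow> 'k tensor) \<Rightarrow> bool" where
  "tensor_linear n T \<longleftrightarrow> (\<forall>x w. T x w = (\<Sum>u\<in>words n. x u * T (basis_tensor u) w))"

lemma tensor_linearD:
  "tensor_linear n T \<Longrightarrow> T x w = (\<Sum>u\<in>words n. x u * T (basis_tensor u) w)"
  unfolding tensor_linear_def by blast

lemma tensor_linear_lin_ext: "tensor_linear n (lin_ext n f)"
proof -
  have "lin_ext n f x w = (\<Sum>u\<in>words n. x u * lin_ext n f (basis_tensor u) w)" for x w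
    unfolding lin_ext_def [of n f x] by (intro sum.cong refl) (simp add: lin_ext_basis_tensor)
  then show ?thesis
    unfolding tensor_linear_def by blast
qed

text \<open>Expand \<open>S\<close>, then \<open>T\<close>, and swap the two finite sums; the inner
  sum is the expansion of \<open>S\<close> at \<open>T (basis_tensor u)\<close>.\<close>

lemma tensor_linear_comp:
  assumes S: "tensor_linear m S" and T: "tensor_linear n T"
  shows "tensor_linear n (S \<circ> T)"
proof -
  have "S (T x) w = (\<Sum>u\<in>words n. x u * S (T (basis_tensor u)) w)" for x w
  proof -
    have "S (T x) w = (\<Sum>v\<in>words m. (\<Sum>u\<in>words n. x u * T (basis_tensor u) v) * S (basis_tensor v) w)"
      by (subst tensor_linearD [OF S], subst tensor_linearD [OF T]) (rule refl)
    also have "\<dots> = (\<Sum>u\<in>words n. x u * (\<Sum>v\<in>words m. T (basis_tensor u) v * S (basis_tensor v) w))"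
      unfolding sum_distrib_left sum_distrib_right by (subst sum.swap) (simp only: mult.assoc)
    also have "\<dots> = (\<Sum>u\<in>words n. x u * S (T (basis_tensor u)) w)"
      by (subst tensor_linearD [OF S, of "T _"]) (rule refl)
    finally show ?thesis .
  qed
  then show ?thesis
    unfolding tensor_linear_def comp_def by blast
qed

text \<open>The leading \<open>S\<close> covers the empty list: its composite is the identity, which
  keeps coordinates outside \<open>words n\<close> and so is not \<open>tensor_linear n\<close>. The
  induction absorbs the head of the list into \<open>S\<close>.\<close>

lemma tensor_linear_comp_list:
  assumes "tensor_linear n S" and "\<And>T. T \<in> set Ts \<Longrightarrow> tensor_linear n T"
  shows "tensor_linear n (S \<circ> compose_list Ts)"
  using assms
proof (induction Ts arbitrary: S)
  case Nil
  then show ?case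
    by (simp add: compose_list_def)
next
  case (Cons T Ts)
  then have "tensor_linear n ((S \<circ> T) \<circ> compose_list Ts)"
    by (intro Cons.IH tensor_linear_comp) auto
  then show ?case
    by (simp add: compose_list_def comp_def)
qed


section \<open>The differentials in low degree\<close>

lemma tensor_linear_R_at: "a + b + 2 = n \<Longrightarrow> tensor_linear n (R_at a b)"
  by (auto simp: R_at_def tens_map_def ac_simps intro: tensor_linear_lin_ext)

text \<open>The bounds make the truncated subtractions exact: \<open>j < i - 1\<close> yields
  \<open>j + (n - 2 - j) + 2 = n\<close>, and \<open>1 + (n - 1) = n\<close>.\<close>

lemma tensor_linear_d_left: "1 \<le> i \<Longrightarrow> i \<le> n \<Longrightarrow> tensor_linear n (d_left i n)"
  unfolding d_left_def
  using tensor_linear_lin_ext [of n]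
  by (intro tensor_linear_comp_list) (auto simp: tens_map_def intro!: tensor_linear_R_at)

lemma tensor_linear_d_right: "1 \<le> i \<Longrightarrow> i \<le> n \<Longrightarrow> tensor_linear n (d_right i n)"
  unfolding d_right_def
  using tensor_linear_lin_ext [of n]
  by (intro tensor_linear_comp_list) (auto simp: tens_map_def intro!: tensor_linear_R_at)

lemma tensor_linear_d_map: "tensor_linear n (d_map n)"
proof -
  have "d_map n x w = (\<Sum>u\<in>words n. x u * d_map n (basis_tensor u) w)" for x w
  proof -
    have "d_map n x w = (\<Sum>i=1..n. \<Sum>u\<in>words n.
        x u * ((-1) ^ i * (d_left i n (basis_tensor u) w - d_right i n (basis_tensor u) w)))"
      unfolding d_map_def
    proof (intro sum.cong refl)
      fix i assume "i \<in> {1..n}"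
      then have "1 \<le> i" "i \<le> n"
        by simp_all
      note linear = tensor_linear_d_left [OF this] tensor_linear_d_right [OF this]
      show "(- 1) ^ i * (d_left i n x w - d_right i n x w) = (\<Sum>u\<in>words n.
        x u * ((-1) ^ i * (d_left i n (basis_tensor u) w - d_right i n (basis_tensor u) w)))"
        unfolding linear [THEN tensor_linearD, of x]
        by (simp only: sum_subtractf [symmetric] sum_distrib_left right_diff_distrib mult.left_commute)
    qed
    also have "\<dots> = (\<Sum>u\<in>words n. x u * d_map n (basis_tensor u) w)"
      unfolding d_map_def sum_distrib_left by (rule sum.swap)
    finally show ?thesis .
  qed
  then show ?thesis
    unfolding tensor_linear_def by blast
qed

section \<open>Values of \<open>R\<close> and \<open>mu\<close> on basis tensors\<close>

lemma R_at_basis_tensor: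
  assumes "length p = a" and "length r = b"
  shows "R_at a b (basis_tensor (p @ s # t # r)) =
    basis_tensor p \<otimes>\<^sub>t (R_basis s t \<otimes>\<^sub>t basis_tensor r)"
proof -
  have "tens_map 2 b R_op id (basis_tensor ([s, t] @ r)) = R_op (basis_tensor [s, t]) \<otimes>\<^sub>t basis_tensor r"
    using assms by (subst tens_map_basis_tensor) simp_all
  moreover have "R_op (basis_tensor [s, t]) = R_basis s t"
    by (simp add: R_op_def lin_ext_basis_tensor words_def)
  ultimately show ?thesis
    using assms by (simp add: R_at_def tens_map_basis_tensor)
qed

lemma R_at_linear:
  "R_at i j (\<lambda>w. a * x w + b * z w) = (\<lambda>w. a * R_at i j x w + b * R_at i j z w)"
  by (simp add: R_at_def tens_map_def lin_ext_linear)

lemma tens_map_linear: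
  "tens_map m n f g (\<lambda>w. a * x w + b * z w) = (\<lambda>w. a * tens_map m n f g x w + b * tens_map m n f g z w)"
  by (simp add: tens_map_def lin_ext_linear)

lemma R_at_I1_I2:
  assumes "length p = a" and "length r = b"
  shows "R_at a b (basis_tensor (p @ I1 # I2 # r)) =
    (\<lambda>w. (1 - Y\<^sup>2) * basis_tensor (p @ I1 # I2 # r) w + Y\<^sup>2 * basis_tensor (p @ I2 # I1 # r) w)"
  using assms by (simp add: R_at_basis_tensor tens_linear_left tens_linear_right)

text \<open>Away from \<open>e_1 \<otimes> e_2\<close> the operator \<open>R\<close> is the flip,
  since equal letters are fixed by it.\<close>

lemma R_at_permute:
  assumes "length p = a" and "length r = b" and "\<not> (s = I1 \<and> t = I2)"
  shows "R_at a b (basis_tensor (p @ s # t # r)) = basis_tensor (p @ t # s # r)"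
  using assms by (cases s; cases t) (simp_all add: R_at_basis_tensor)

lemma mu_left_basis_tensor:
  "length u = n \<Longrightarrow> tens_map 1 n mu_op id (basis_tensor (i # u)) = basis_tensor u"
  using tens_map_basis_tensor [of "[i]" 1 u n mu_op id]
  by (simp add: mu_op_def lin_ext_basis_tensor words_def)

lemma mu_right_basis_tensor:
  "length u = n \<Longrightarrow> tens_map n 1 id mu_op (basis_tensor (u @ [i])) = basis_tensor u"
  using tens_map_basis_tensor [of u n "[i]" 1 id mu_op]
  by (simp add: mu_op_def lin_ext_basis_tensor words_def)

text \<open>In degrees two and three at most one letter precedes the pair on which \<open>R\<close>
  acts. Simplifying the instances removes the appends, so they match explicit words.\<close>

lemmas R_at_simps =
  R_at_I1_I2 [of "[]", simplified] R_at_permute [of "[]", simplified]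
  R_at_I1_I2 [of "[i]" for i, simplified] R_at_permute [of "[i]" for i, simplified]

lemmas mu_simps =
  mu_left_basis_tensor [of "[i]" for i, simplified] mu_left_basis_tensor [of "[i, j]" for i j, simplified]
  mu_right_basis_tensor [of "[i]" for i, simplified] mu_right_basis_tensor [of "[i, j]" for i j, simplified]

section \<open>Face maps and differentials in degrees two and three\<close>

lemma d_left_2:
  "d_left 1 2 = tens_map 1 1 mu_op id"
  "d_left 2 2 = (\<lambda>x. tens_map 1 1 mu_op id (R_at 0 0 x))"
  by (simp_all add: d_left_def compose_list_def fun_eq_iff)

lemma d_right_2:
  "d_right 1 2 = (\<lambda>x. tens_map 1 1 id mu_op (R_at 0 0 x))"
  "d_right 2 2 = tens_map 1 1 id mu_op"
  by (simp_all add: d_right_def compose_list_def fun_eq_iff)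

lemma d_left_3:
  "d_left 1 3 = tens_map 1 2 mu_op id"
  "d_left 2 3 = (\<lambda>x. tens_map 1 2 mu_op id (R_at 0 1 x))"
  "d_left 3 3 = (\<lambda>x. tens_map 1 2 mu_op id (R_at 0 1 (R_at 1 0 x)))"
  by (simp_all add: d_left_def compose_list_def fun_eq_iff upt_rec)

lemma d_right_3:
  "d_right 1 3 = (\<lambda>x. tens_map 2 1 id mu_op (R_at 1 0 (R_at 0 1 x)))"
  "d_right 2 3 = (\<lambda>x. tens_map 2 1 id mu_op (R_at 1 0 x))"
  "d_right 3 3 = tens_map 2 1 id mu_op"
  by (simp_all add: d_right_def compose_list_def fun_eq_iff upt_rec)

lemma d_map_2:
  "d_map 2 x w = - (d_left 1 2 x w - d_right 1 2 x w) + (d_left 2 2 x w - d_right 2 2 x w)"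
proof -
  have "{1..2::nat} = {1, 2}"
    by auto
  then show ?thesis
    by (simp add: d_map_def)
qed

lemma d_map_3:
  "d_map 3 x w = - (d_left 1 3 x w - d_right 1 3 x w) + (d_left 2 3 x w - d_right 2 3 x w)
    - (d_left 3 3 x w - d_right 3 3 x w)"
proof -
  have "{1..3::nat} = {1, 2, 3}"
    by auto
  then show ?thesis
    by (simp add: d_map_def)
qed

text \<open>Where \<open>R\<close> is the flip, each left face equals the right face of the same
  index. On \<open>e_1 \<otimes> e_2\<close> both differences of faces equal (1 - q)(e_2 - e_1) with
  q = y^2, and they enter with opposite signs.\<close>

lemma d_map_2_basis_tensor: "d_map 2 (basis_tensor [i, j]) w = 0"
  unfolding d_map_2 d_left_2 d_right_2
  by (cases i; cases j)
    (simp_all add: R_at_simps mu_simps R_at_linear tens_map_linear, simp add: algebra_simps)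

lemma d_map_2_eq_0: "d_map 2 x = (\<lambda>_. 0)"
proof
  fix w
  have "d_map 2 (basis_tensor u) w = 0" if "u \<in> words 2" for u
    using that d_map_2_basis_tensor by (auto simp: words_def length_Suc_conv numeral_2_eq_2)
  then show "d_map 2 x w = 0"
    by (subst tensor_linearD [OF tensor_linear_d_map]) simp
qed

lemma d_map_3_basis_tensor: "d_map 3 (basis_tensor [i, j, k]) w =
   (if i = I1 \<and> j = I1 \<and> k = I2 then
      (1 - Y ^ 4) * basis_tensor [I1, I1] w
        + (Y\<^sup>2 - 1) * (basis_tensor [I1, I2] w + Y\<^sup>2 * basis_tensor [I2, I1] w)
    else if i = I1 \<and> j = I2 \<and> k = I2 then
      (1 - Y\<^sup>2) * (basis_tensor [I1, I2] w + Y\<^sup>2 * basis_tensor [I2, I1] w)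
        + (Y ^ 4 - 1) * basis_tensor [I2, I2] w
    else 0)"
  unfolding d_map_3 d_left_3 d_right_3
  \<comment> \<open>The flipped \<open>power_add\<close> merges \<open>Y\<^sup>2 * Y\<^sup>2\<close>
    into \<open>Y ^ 4\<close>, the form used on the right-hand side.\<close>
  by (cases i; cases j; cases k)
    (simp_all add: R_at_simps mu_simps R_at_linear tens_map_linear,
      (simp add: algebra_simps flip: power_add)+)

text \<open>Only two of the eight coordinates of \<open>x\<close> survive. Linearity of the
  differential, its target degree and the description of its image are all read off this closed
  form.\<close>

lemma d_map_3_eq:
  "d_map 3 x = (\<lambda>w. (1 - Y ^ 4) * x [I1, I1, I2] * basis_tensor [I1, I1] w
    + (Y\<^sup>2 - 1) * (x [I1, I1, I2] - x [I1, I2, I2])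
        * (basis_tensor [I1, I2] w + Y\<^sup>2 * basis_tensor [I2, I1] w)
    + (Y ^ 4 - 1) * x [I1, I2, I2] * basis_tensor [I2, I2] w)"
proof
  fix w
  have "d_map 3 x w = (\<Sum>u\<in>words 3. x u * d_map 3 (basis_tensor u) w)"
    by (rule tensor_linearD [OF tensor_linear_d_map])
  \<comment> \<open>The successor form lets \<open>sum_words_Suc\<close> unroll the sum letter by
    letter.\<close>
  also have "words 3 = words (Suc (Suc (Suc 0)))"
    by (simp add: numeral_3_eq_3)
  finally show "d_map 3 x w = (1 - Y ^ 4) * x [I1, I1, I2] * basis_tensor [I1, I1] w
    + (Y\<^sup>2 - 1) * (x [I1, I1, I2] - x [I1, I2, I2])
        * (basis_tensor [I1, I2] w + Y\<^sup>2 * basis_tensor [I2, I1] w)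
    + (Y ^ 4 - 1) * x [I1, I2, I2] * basis_tensor [I2, I2] w"
    by (simp add: sum_words_Suc words_0 d_map_3_basis_tensor) (simp add: algebra_simps)
qed

section \<open>Boundaries and the second homology\<close>

lemma d_map_3_module_hom:
  "d_map 3 \<in> LinearCombinations.module_hom class_ring (chain_module 3) (chain_module 2)"
  by (auto simp: LinearCombinations.module_hom_def d_map_3_eq tensor_power_def
      basis_tensor_def words_def fun_eq_iff algebra_simps)

lemma submodule_boundaries:
  "LinearCombinations.submodule class_ring (d_map 3 ` carrier (chain_module 3)) (chain_module 2)"
proof -
  interpret mod_hom class_ring "chain_module 3" "chain_module 2" "d_map 3"
    using d_map_3_module_hom
    by (simp add: mod_hom_def mod_hom_axioms_def module_tensor_power)
  show ?thesis
    using im_is_submodule by (simp add: im_def)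
qed

text \<open>In the basis v, w, e_21, e_22, the element \<open>x\<close> has coordinates x_12, x_11,
  x_21 - q x_12 and x_22 + (1 + q) x_12 + x_11. Membership in the span of (q - 1) v and (q^2 - 1) w
  is a condition on each of them separately.\<close>

lemma boundaries_iff:
  assumes "x \<in> carrier (chain_module 2)"
  shows "x \<in> d_map 3 ` carrier (chain_module 3) \<longleftrightarrow>
    x [I2, I1] = Y\<^sup>2 * x [I1, I2] \<and> x [I2, I2] + (1 + Y\<^sup>2) * x [I1, I2] + x [I1, I1] = 0 \<and>
    Y\<^sup>2 - 1 dvd x [I1, I2] \<and> Y ^ 4 - 1 dvd x [I1, I1]" (is "_ \<longleftrightarrow> ?rhs")
proof
  assume "x \<in> d_map 3 ` carrier (chain_module 3)"
  then obtain z where x: "x = d_map 3 z"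
    by blast
  have "Y ^ 4 - 1 dvd (1 - Y ^ 4) * z [I1, I1, I2]"
    by (metis dvd_minus_iff dvd_mult2 dvd_refl minus_diff_eq)
  then show ?rhs
    unfolding x d_map_3_eq
    by (simp add: basis_tensor_def) (simp add: algebra_simps flip: power_add)
next
  assume ?rhs
  then obtain s t where st: "x [I1, I2] = (Y\<^sup>2 - 1) * s" "x [I1, I1] = (Y ^ 4 - 1) * t"
    by (auto elim!: dvdE)
  have x21: "x [I2, I1] = Y\<^sup>2 * x [I1, I2]"
    and "x [I2, I2] + (1 + Y\<^sup>2) * x [I1, I2] + x [I1, I1] = 0"
    using \<open>?rhs\<close> by blast+
  then have x22: "x [I2, I2] = - ((1 + Y\<^sup>2) * x [I1, I2] + x [I1, I1])"
    by (simp only: eq_neg_iff_add_eq_0 add.assoc)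
  \<comment> \<open>The e_11 coordinate of the image forces the first value \<open>- t\<close>; the
    e_12 coordinate is (q - 1) times the difference of the two values, which must therefore be
    \<open>s\<close>.\<close>
  let ?z = "\<lambda>w. if w = [I1, I1, I2] then - t else if w = [I1, I2, I2] then - t - s else 0"
  have "x w = d_map 3 ?z w" for w
  proof (cases "w \<in> words 2")
    case True
    then obtain i j where "w = [i, j]"
      by (auto simp: words_def length_Suc_conv numeral_2_eq_2)
    then show ?thesis
      by (cases i; cases j; simp add: d_map_3_eq basis_tensor_def x21 x22 st)
        (simp_all add: algebra_simps flip: power_add)
  next
    case False
    then show ?thesis
      using assms by (auto simp: d_map_3_eq basis_tensor_def tensor_power_def words_def)
  qed
  then have "x = d_map 3 ?z"
    by blast
  moreover have "?z \<in> carrier (chain_module 3)"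
    by (auto simp: tensor_power_def words_def)
  ultimately show "x \<in> d_map 3 ` carrier (chain_module 3)"
    by blast
qed

text \<open>Since the differential on 2-chains is zero, every 2-chain is a cycle, and the carrier
  update in \<open>homology\<close> changes nothing.\<close>

lemma homology_2:
  "homology 2 = quotient_module (chain_module 2) (d_map 3 ` carrier (chain_module 3))"
proof -
  have "a_kernel (chain_module 2) (chain_module 1) (d_map 2) = carrier (chain_module 2)"
    by (auto simp: a_kernel_def' d_map_2_eq_0) (simp add: tensor_power_def)
  then show ?thesis
    by (simp add: homology_def)
qed

theorem theorem5p4:
  shows "module_iso k_ring (homology 2)
    (direct_sum (direct_sum k_module k_module)
      (direct_sum (k_mod (Y\<^sup>2 - 1)) (k_mod (Y ^ 4 - 1))))"
proof -
  \<comment> \<open>The projection of k onto k/(a). The facts below turn equality of its values into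
    divisibility by \<open>a\<close>.\<close>
  define p :: "laurent \<Rightarrow> laurent \<Rightarrow> laurent set"
    where "p a x = PIdl\<^bsub>k_ring\<^esub> a +>\<^bsub>k_module\<^esub> x" for a x
  have sub: "LinearCombinations.submodule k_ring (PIdl\<^bsub>k_ring\<^esub> a) k_module" for a
    by (rule submodule_cgenideal [OF class_cring.cring_axioms]) simp
  have p_hom: "p a \<in> LinearCombinations.module_hom k_ring k_module (k_mod a)" for a
    using coset_map_module_hom [OF sub] by (simp add: p_def [abs_def])
  have p_surj: "carrier (k_mod a) = range (p a)" for a
    by (auto simp: quotient_module_def A_RCOSETS_def' p_def regular_module_def)
  have p_eq: "p a x = p a y \<longleftrightarrow> a dvd x - y" for a x y
    using a_r_coset_eq_iff [OF submodule_imp_abelian_subgroup [OF sub], of x y a]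
    by (simp add: p_def a_minus_regular_module mem_cgenideal_class_ring_iff class_ring_simps)
      (simp add: regular_module_def)
  have p_add: "p a (x + y) = p a x \<oplus>\<^bsub>k_mod a\<^esub> p a y"
    and p_smult: "p a (r * x) = r \<odot>\<^bsub>k_mod a\<^esub> p a x" for a r x y
    using p_hom [of a] by (auto simp: LinearCombinations.module_hom_def regular_module_def)
  let ?P = "direct_sum (direct_sum k_module k_module)
      (direct_sum (k_mod (Y\<^sup>2 - 1)) (k_mod (Y ^ 4 - 1)))"
  \<comment> \<open>The coordinates at e_21 and e_22 give the free part; those at v and w are
    reduced modulo q - 1 and q^2 - 1.\<close>
  define f where "f x = ((x [I2, I1] - Y\<^sup>2 * x [I1, I2],
      x [I2, I2] + (1 + Y\<^sup>2) * x [I1, I2] + x [I1, I1]),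
      (p (Y\<^sup>2 - 1) (x [I1, I2]), p (Y ^ 4 - 1) (x [I1, I1])))" for x
  have f_hom: "f \<in> LinearCombinations.module_hom k_ring (chain_module 2) ?P"
    by (auto simp: LinearCombinations.module_hom_def f_def direct_sum_def p_surj)
      (simp_all add: tensor_power_def regular_module_def p_add p_smult algebra_simps)
  have "f ` carrier (chain_module 2) = carrier ?P"
  proof
    show "f ` carrier (chain_module 2) \<subseteq> carrier ?P"
      using f_hom by (auto simp: LinearCombinations.module_hom_def)
    show "carrier ?P \<subseteq> f ` carrier (chain_module 2)"
    proof
      fix v assume "v \<in> carrier ?P"
      then obtain a b c d where v: "v = ((a, b), (p (Y\<^sup>2 - 1) c, p (Y ^ 4 - 1) d))"
        by (auto simp: direct_sum_def p_surj)
      \<comment> \<open>The coordinate system is triangular: x_11 and x_12 are lifts of the two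
        classes, and x_21 and x_22 are then solved for.\<close>
      let ?x = "\<lambda>w. if w = [I1, I1] then d else if w = [I1, I2] then c
        else if w = [I2, I1] then a + Y\<^sup>2 * c
        else if w = [I2, I2] then b - (1 + Y\<^sup>2) * c - d else 0"
      have "v = f ?x"
        by (simp add: v f_def)
      moreover have "?x \<in> carrier (chain_module 2)"
        by (auto simp: tensor_power_def words_def)
      ultimately show "v \<in> f ` carrier (chain_module 2)"
        by blast
    qed
  qed
  \<comment> \<open>The coordinates are additive, so equality of the four components is exactly the
    criterion of \<open>boundaries_iff\<close> for the difference.\<close>
  moreover have "f x = f y \<longleftrightarrow> x \<ominus>\<^bsub>chain_module 2\<^esub> y \<in> d_map 3 ` carrier (chain_module 3)"
    if "x \<in> carrier (chain_module 2)" and "y \<in> carrier (chain_module 2)" for x y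
  proof -
    interpret Module.module k_ring "chain_module 2"
      by (rule module_tensor_power)
    have "x \<ominus>\<^bsub>chain_module 2\<^esub> y \<in> carrier (chain_module 2)"
      using that by simp
    then show ?thesis
      using that
      by (simp add: boundaries_iff a_minus_tensor_power f_def p_eq) (auto simp: algebra_simps)
  qed
  ultimately show ?thesis
    unfolding homology_2 using submodule_boundaries f_hom
    by (intro module_iso_quotient_module) auto
qed

end
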